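(* There exists a subset $H$ of $\mathbb{I}$ which is not $\sigma$-compact and such that: (1) $|H|=\mathfrak{b}$; (2) $H$ satisfies $\mathsf{S}_1(\Gamma,\mathcal{O})$ and all finite powers $H^k$ satisfy $\mathsf{U}_{fin}(\Gamma,\Gamma)$, but $H\setminus Q$ does not satisfy $\mathsf{U}_{fin}(\Gamma,\Gamma)$; (3) if $\mathfrak{b}=\mathfrak{d}$, then $H\setminus Q$ does not satisfy $\mathsf{U}_{fin}(\Gamma,\mathcal{O})$.
   Context: Let $\overline{\mathbb{N}}=\mathbb{N}\cup\{\infty\}$ be the one-point compactification of $\mathbb{N}$. Let $\mathbb{I}\subseteq\overline{\mathbb{N}}^{\mathbb{N}}$ (product topology) be the set of nondecreasing functions $f$ such that $f(n)<f(n+1)$ whenever $f(n)<\infty$; $\mathbb{I}$ is homeomorphic to the Cantor space. For each finite strictly increasing sequence $s$ of natural numbers, $q_s\in\mathbb{I}$ is given by $q_s(k)=s(k)$ for $k<|s|$ and $q_s(k)=\infty$ otherwise; $Q=\{q_s\}$ (a countable dense subset of $\mathbb{I}$). $\mathfrak{b}$ and $\mathfrak{d}$ are the bounding and dominating numbers. For a space $X$: $\mathcal{O}$ is the collection of countable open covers, $\Gamma$ the countable open $\gamma$-covers (infinite open covers with $X$ not contained in any member and each point in all but finitely many members). $\mathsf{S}_1(\Gamma,\mathcal{O})$: for each sequence $(\mathcal{U}_n)$ of members of $\Gamma$ there exist $U_n\in\mathcal{U}_n$ with $\{U_n\}$ a cover of $X$. $\mathsf{U}_{fin}(\Gamma,\mathscr{B})$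 (for $\mathscr{B}\in\{\Gamma,\mathcal{O}\}$): for each sequence $(\mathcal{U}_n)$ of members of $\Gamma$ none containing a finite subcover, there exist finite $\mathcal{F}_n\subseteq\mathcal{U}_n$ with $\{\bigcup\mathcal{F}_n:n\in\mathbb{N}\}\in\mathscr{B}$. *)

theory Defs
  imports "HOL-Analysis.Analysis"
begin

unbundle cardinal_syntax

text \<open>
  The order topology of \<^typ>\<open>enat\<close> is that of the one-point compactification of the naturals, and
  the topology of \<^typ>\<open>nat \<Rightarrow> enat\<close> is the product topology.
\<close>

definition incr_seqs :: "(nat \<Rightarrow> enat) set" where
  "incr_seqs = {f. mono f \<and> (\<forall>n. f n < \<infinity> \<longrightarrow> f n < f (Suc n))}"

definition q_seq :: "nat list \<Rightarrow> nat \<Rightarrow> enat" where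
  "q_seq s k = (if k < length s then enat (s ! k) else \<infinity>)"

definition Q_seqs :: "(nat \<Rightarrow> enat) set" where
  "Q_seqs = q_seq ` {s. sorted_wrt (<) s}"

definition eventually_le :: "(nat \<Rightarrow> nat) \<Rightarrow> (nat \<Rightarrow> nat) \<Rightarrow> bool" (infix "\<le>\<^sup>*" 50) where
  "f \<le>\<^sup>* g \<longleftrightarrow> (\<forall>\<^sub>F n in sequentially. f n \<le> g n)"

definition unbounded_family :: "(nat \<Rightarrow> nat) set \<Rightarrow> bool" where
  "unbounded_family B \<longleftrightarrow> \<not> (\<exists>g. \<forall>f\<in>B. f \<le>\<^sup>* g)"

definition dominating_family :: "(nat \<Rightarrow> nat) set \<Rightarrow> bool" where
  "dominating_family D \<longleftrightarrow> (\<forall>f. \<exists>g\<in>D. f \<le>\<^sup>* g)"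

text \<open>
  Cardinals are cardinal-order relations, to be compared with \<open>=o\<close> and not with HOL equality;
  up to \<open>=o\<close> the choice made here is immaterial (lemma \<open>min_card_unique\<close>).
\<close>

definition min_card :: "('a set \<Rightarrow> bool) \<Rightarrow> 'a rel" where
  "min_card P = |SOME A. P A \<and> (\<forall>B. P B \<longrightarrow> |A| \<le>o |B| )|"

definition bounding_number :: "(nat \<Rightarrow> nat) rel" ("\<bb>") where
  "\<bb> = min_card unbounded_family"

definition dominating_number :: "(nat \<Rightarrow> nat) rel" ("\<dd>") where
  "\<dd> = min_card dominating_family"

lemma min_card_attained:
  assumes "P A"
  shows "\<exists>B. P B \<and> (\<forall>C. P C \<longrightarrow> |B| \<le>o |C| ) \<and> min_card P = |B|"
proof -
  have "\<exists>r\<in>card_of ` Collect P. \<forall>r'\<in>card_of ` Collect P. r \<le>o r'"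
    using assms by (intro exists_minim_Card_order) (auto simp: card_of_Card_order)
  then have "\<exists>B. P B \<and> (\<forall>C. P C \<longrightarrow> |B| \<le>o |C| )" by auto
  from someI_ex[OF this] show ?thesis unfolding min_card_def by blast
qed

lemma min_card_unique:
  assumes "P B" "\<And>C. P C \<Longrightarrow> |B| \<le>o |C|"
  shows "min_card P =o |B|"
  using min_card_attained[of P B] assms by (auto simp: ordIso_iff_ordLeq)

lemma dominating_family_UNIV: "dominating_family UNIV"
proof -
  have "f \<le>\<^sup>* f" for f
    by (simp add: eventually_le_def)
  then show ?thesis unfolding dominating_family_def by blast
qed

lemma unbounded_family_UNIV: "unbounded_family UNIV"
proof -
  have "\<not> (\<lambda>n. Suc (g n)) \<le>\<^sup>* g" for g
    by (simp add: eventually_le_def)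
  then show ?thesis unfolding unbounded_family_def by blast
qed

definition open_covers :: "'a topology \<Rightarrow> 'a set set set" ("\<O>") where
  "\<O> X = {U. countable U \<and> (\<forall>V\<in>U. openin X V) \<and> topspace X \<subseteq> \<Union>U}"

definition gamma_covers :: "'a topology \<Rightarrow> 'a set set set" ("\<Gamma>") where
  "\<Gamma> X = {U \<in> \<O> X. infinite U \<and> (\<forall>V\<in>U. \<not> topspace X \<subseteq> V) \<and>
           (\<forall>x\<in>topspace X. finite {V \<in> U. x \<notin> V})}"

definition S1 ::
  "('a topology \<Rightarrow> 'a set set set) \<Rightarrow> ('a topology \<Rightarrow> 'a set set set) \<Rightarrow> 'a topology \<Rightarrow> bool" where
  "S1 A B X \<longleftrightarrow> (\<forall>U :: nat \<Rightarrow> 'a set set. (\<forall>n. U n \<in> A X) \<longrightarrow>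
     (\<exists>V. (\<forall>n. V n \<in> U n) \<and> range V \<in> B X))"

definition Ufin ::
  "('a topology \<Rightarrow> 'a set set set) \<Rightarrow> ('a topology \<Rightarrow> 'a set set set) \<Rightarrow> 'a topology \<Rightarrow> bool" where
  "Ufin A B X \<longleftrightarrow> (\<forall>U :: nat \<Rightarrow> 'a set set.
     (\<forall>n. U n \<in> A X \<and> \<not> (\<exists>F. finite F \<and> F \<subseteq> U n \<and> topspace X \<subseteq> \<Union>F)) \<longrightarrow>
     (\<exists>F. (\<forall>n. finite (F n) \<and> F n \<subseteq> U n) \<and> range (\<lambda>n. \<Union>(F n)) \<in> B X))"

definition sigma_compact :: "'a::topological_space set \<Rightarrow> bool" where
  "sigma_compact S \<longleftrightarrow> (\<exists>K :: nat \<Rightarrow> 'a set. (\<forall>n. compact (K n)) \<and> S = (\<Union>n. K n))"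

definition power_topology :: "'a topology \<Rightarrow> nat \<Rightarrow> (nat \<Rightarrow> 'a) topology" where
  "power_topology X k = product_topology (\<lambda>_. X) {..<k}"

end

theory Submission
  imports Defs
begin

text \<open>
  Let \<open>B\<close> be a \<open>\<bb>\<close>-scale: an unbounded family of increasing functions, well-ordered by \<open>\<le>\<^sup>*\<close> in type
  \<open>\<bb>\<close>, and dominating if \<open>\<bb> = \<dd>\<close>. Take \<open>H = B \<union> Q\<close>.

  The sets \<open>{x. x n = \<infinity>}\<close> are compact and contained in \<open>Q\<close>, so every open set containing \<open>Q\<close>
  contains \<open>{x. g n < x n}\<close> for suitable \<open>g n\<close>. All but fewer than \<open>\<bb>\<close> many elements of \<open>B\<close> meet such
  a condition for some \<open>n\<close>, and fewer than \<open>\<bb>\<close> many points are handled by a bounding function; this is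
  \<open>S\<^sub>1(\<Gamma>, \<O>)\<close>. For the Hurewicz property of powers, if \<open>f0 \<in> B\<close> exceeds \<open>g\<close> on an infinite set \<open>J\<close>, then
  every \<open>f \<in> B\<close> above \<open>f0\<close> exceeds \<open>g\<close> on almost all of the same set \<open>J\<close>, and a bound along \<open>J\<close> suffices
  after making the covers decrease; tuples with a coordinate below \<open>f0\<close> lie in fewer than \<open>\<bb>\<close> many
  sections, which are powers of smaller exponent.

  If \<open>H\<close> were \<open>\<sigma>\<close>-compact, some compact piece would contain a compact set \<open>P\<close> all of whose nonempty
  relatively open subsets are unbounded. Choosing \<open>x \<in> P \<inter> B\<close> not below a bound of a countable dense
  subset of \<open>P \<inter> B\<close>, a generic \<open>y \<in> P\<close> lies in \<open>B\<close> and is \<open>\<le>\<^sup>*\<close>-incomparable with \<open>x\<close>.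
\<close>

section \<open>Scales\<close>

lemma eventually_le_trans: "f \<le>\<^sup>* g \<Longrightarrow> g \<le>\<^sup>* h \<Longrightarrow> f \<le>\<^sup>* h"
  unfolding eventually_le_def by (auto elim: eventually_elim2)

text \<open>Diagonalization: the bound at \<open>n\<close> sums the members with index up to
  \<open>n\<close>, so it is above the \<open>k\<close>-th member from \<open>k\<close> on.\<close>

lemma bounded_family_if_countable:
  assumes "countable A"
  shows "\<exists>g. \<forall>f\<in>A. f \<le>\<^sup>* g"
proof (cases "A = {}")
  case False
  define F where "F = from_nat_into A"
  have "F k \<le>\<^sup>* (\<lambda>n. \<Sum>i\<le>n. F i n)" for k
    unfolding eventually_le_def eventually_sequentially
    by (intro exI[of _ k] allI impI) (auto intro: member_le_sum)
  with assms False show ?thesis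
    unfolding F_def by (metis from_nat_into_surj)
qed auto

text \<open>Monotonicity spreads a bound along \<open>J\<close> to all arguments: \<open>f n\<close>
  is at most the value of \<open>f\<close> at the next element of \<open>J\<close>.\<close>

lemma bounded_family_if_infinitely_often_bounded:
  assumes "\<And>f. f \<in> A \<Longrightarrow> mono f" and "infinite J"
    and "\<And>f. f \<in> A \<Longrightarrow> \<exists>N. \<forall>n\<in>J. N \<le> n \<longrightarrow> f n \<le> h n"
  shows "\<exists>g. \<forall>f\<in>A. f \<le>\<^sup>* (g :: nat \<Rightarrow> nat)"
proof -
  have "\<exists>m. m \<in> J \<and> n \<le> m" for n
    using assms(2) infinite_nat_iff_unbounded_le by auto
  then obtain nxt where nxt: "\<And>n. nxt n \<in> J" "\<And>n. n \<le> nxt n" by metis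
  have "f \<le>\<^sup>* (\<lambda>n. h (nxt n))" if f: "f \<in> A" for f
  proof -
    obtain N where N: "\<forall>n\<in>J. N \<le> n \<longrightarrow> f n \<le> h n" using assms(3) f by blast
    have "f n \<le> h (nxt n)" if "N \<le> n" for n
      using monoD[OF assms(1)[OF f] nxt(2)[of n]] N nxt[of n] that
      by (meson order_trans)
    then show ?thesis unfolding eventually_le_def eventually_sequentially by blast
  qed
  then show ?thesis by blast
qed

text \<open>An index-free form of a scale: \<open>linear\<close> and \<open>card_below\<close> stand
  for the well-ordering, since every initial segment under \<open>\<le>\<^sup>*\<close> is smaller
  than the whole, and \<open>small_bounded\<close> gives such segments upper bounds.\<close>

locale b_scale =
  fixes B :: "(nat \<Rightarrow> nat) set"
  assumes strict_mono: "f \<in> B \<Longrightarrow> strict_mono f"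
    and linear: "f \<in> B \<Longrightarrow> g \<in> B \<Longrightarrow> f \<le>\<^sup>* g \<or> g \<le>\<^sup>* f"
    and unbounded: "unbounded_family B"
    and small_bounded: "|A| <o |B| \<Longrightarrow> \<exists>g. \<forall>f\<in>A. f \<le>\<^sup>* g"
    and card_below: "|{f \<in> B. f \<le>\<^sup>* g}| <o |B|"

text \<open>Recursion along the cardinal order of \<open>A\<close>: at each stage fewer than
  \<open>|A|\<close> values have been chosen, so minimality of \<open>A\<close> bounds them. Keeping
  each value above \<open>a\<close> itself makes the scale inherit unboundedness, and also
  domination, from \<open>A\<close>.\<close>

lemma b_scale_exists:
  assumes A: "unbounded_family A" and min: "\<And>C. unbounded_family C \<Longrightarrow> |A| \<le>o |C|"
  shows "\<exists>B. b_scale B \<and> |B| =o |A| \<and> (\<forall>a\<in>A. \<exists>f\<in>B. a \<le>\<^sup>* f)"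
proof -
  define r where "r = |A|"
  have wo: "Well_order r" and fld: "Field r = A" and co: "Card_order r"
    unfolding r_def by (rule card_of_Well_order Field_card_of card_of_Card_order)+
  have small: "\<exists>g. \<forall>f\<in>C. f \<le>\<^sup>* g" if "|C| <o |A|" for C :: "(nat \<Rightarrow> nat) set"
    using min[of C] that not_ordLess_ordLeq unfolding unbounded_family_def by blast
  \<comment> \<open>The admissible values at stage \<open>a\<close>. The condition reads
    \<open>F\<close> only at predecessors of \<open>a\<close> and is vacuous off \<open>A\<close>,
    as dependent choice along the well-founded order on the whole type demands.\<close>
  define P where "P F a v \<longleftrightarrow> (a \<in> A \<longrightarrow> strict_mono v \<and> a \<le>\<^sup>* v \<and> (\<forall>c\<in>underS r a. F c \<le>\<^sup>* v))"
    for F :: "(nat \<Rightarrow> nat) \<Rightarrow> nat \<Rightarrow> nat" and a v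
  have "\<exists>F. \<forall>a. P F a (F a)"
  proof (rule dependent_wf_choice)
    show "wf (r - Id)" using wo unfolding well_order_on_def by blast
    show "P f x v = P g x v" if "\<And>z. (z, x) \<in> r - Id \<Longrightarrow> f z = g z" for f g x v
      using that unfolding P_def underS_def by auto
    show "\<exists>v. P F a v" for a F
    proof (cases "a \<in> A")
      case True
      have "|F ` underS r a| <o |A|"
        using card_of_image card_of_underS[OF co] True fld r_def ordLeq_ordLess_trans by metis
      then obtain g where g: "\<forall>f\<in>F ` underS r a. f \<le>\<^sup>* g" using small by blast
      define v where "v n = (\<Sum>i\<le>n. Suc (a i + g i))" for n
      have "strict_mono v" unfolding v_def strict_mono_Suc_iff by simp
      moreover have le: "a n + g n \<le> v n" for n
        using member_le_sum[of n "{..n}" "\<lambda>i. Suc (a i + g i)"] unfolding v_def by simp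
      have "a \<le>\<^sup>* v" "g \<le>\<^sup>* v"
        using le by (auto simp: eventually_le_def intro!: always_eventually intro: add_leD1 add_leD2)
      ultimately show ?thesis
        using g unfolding P_def by (blast intro: eventually_le_trans)
    qed (auto simp: P_def)
  qed
  then obtain F where "\<forall>a. P F a (F a)" by blast
  then have F: "strict_mono (F a)" "a \<le>\<^sup>* F a" "\<And>c. c \<in> underS r a \<Longrightarrow> F c \<le>\<^sup>* F a"
    if "a \<in> A" for a using that unfolding P_def by blast+
  have tot: "a \<in> underS r c \<or> a = c \<or> c \<in> underS r a" if "a \<in> A" "c \<in> A" for a c
    using wo that fld unfolding well_order_on_def linear_order_on_def total_on_def underS_def by blast
  have refl: "f \<le>\<^sup>* f" for f by (simp add: eventually_le_def)
  define B where "B = F ` A"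
  have unb: "unbounded_family B"
    using A F(2) unfolding unbounded_family_def B_def by (meson eventually_le_trans imageI)
  \<comment> \<open>\<open>F\<close> may fail to be injective, so the lower bound comes from
    minimality of \<open>A\<close> applied to the unbounded family \<open>B\<close>.\<close>
  have card: "|B| =o |A|"
    using min[OF unb] card_of_image[of F A] unfolding B_def by (simp add: ordIso_iff_ordLeq)
  have "b_scale B"
  proof
    show "strict_mono f" if "f \<in> B" for f using that F unfolding B_def by auto
    show "f \<le>\<^sup>* g \<or> g \<le>\<^sup>* f" if "f \<in> B" "g \<in> B" for f g
      using that F(3) tot refl unfolding B_def by blast
    show "unbounded_family B" by (fact unb)
    show "\<exists>g. \<forall>f\<in>C. f \<le>\<^sup>* g" if "|C| <o |B|" for C :: "(nat \<Rightarrow> nat) set"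
      using small that card ordLess_ordIso_trans by blast
    show "|{f \<in> B. f \<le>\<^sup>* g}| <o |B|" for g
    proof -
      \<comment> \<open>A stage whose value escapes \<open>g\<close>; all later values are above it
        and escape too, so those below \<open>g\<close> come from earlier stages.\<close>
      obtain a where a: "a \<in> A" "\<not> F a \<le>\<^sup>* g"
        using unb unfolding unbounded_family_def B_def by auto
      have "c \<in> underS r a" if "c \<in> A" "F c \<le>\<^sup>* g" for c
        using tot[OF that(1) a(1)] a that F(3)[OF that(1)] eventually_le_trans by blast
      then have "{f \<in> B. f \<le>\<^sup>* g} \<subseteq> F ` underS r a" unfolding B_def by auto
      then have "|{f \<in> B. f \<le>\<^sup>* g}| \<le>o |underS r a|"
        using card_of_mono1 card_of_image ordLeq_transitive by blast
      moreover have "|underS r a| <o |A|"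
        using card_of_underS[OF co] a fld r_def by metis
      ultimately show ?thesis
        using card ordIso_symmetric ordLeq_ordLess_trans ordLess_ordIso_trans by blast
    qed
  qed
  with card F(2) show ?thesis unfolding B_def by blast
qed

section \<open>The space of increasing sequences\<close>

text \<open>Since \<open>\<infinity> + 1 = \<infinity>\<close>, one weak inequality covers the
  finite and the infinite case; in this form the set is visibly closed.\<close>

lemma incr_seqs_eq: "incr_seqs = {f. \<forall>n. f n + 1 \<le> f (Suc n)}"
proof (intro set_eqI iffI)
  fix f assume "f \<in> incr_seqs"
  then have f: "mono f" "\<And>n. f n < \<infinity> \<Longrightarrow> f n < f (Suc n)" unfolding incr_seqs_def by auto
  have "f n + 1 \<le> f (Suc n)" for n
    using f(2)[of n] monoD[OF f(1), of n "Suc n"]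
    by (cases "f n") (auto simp: eSuc_plus_1[symmetric] ileI1)
  then show "f \<in> {f. \<forall>n. f n + 1 \<le> f (Suc n)}" by simp
next
  fix f :: "nat \<Rightarrow> enat" assume f: "f \<in> {f. \<forall>n. f n + 1 \<le> f (Suc n)}"
  have le: "f n + 1 \<le> f (Suc n)" for n using f by simp
  have "mono f"
    unfolding mono_iff_le_Suc using le by (meson le_iff_add order_trans)
  moreover have "f n < f (Suc n)" if "f n < \<infinity>" for n
    using le[of n] that by (cases "f n"; cases "f (Suc n)") (auto simp: one_enat_def)
  ultimately show "f \<in> incr_seqs" unfolding incr_seqs_def by simp
qed

lemma compactin_incr_seqs: "compactin euclidean incr_seqs"
proof -
  have "compact_space (product_topology (\<lambda>_::nat. euclidean :: enat topology) UNIV)"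
    using compact_UNIV[where 'a=enat] by (simp add: compact_space_product_topology compact_space_def[of euclidean])
  then have "compactin euclidean (UNIV :: (nat \<Rightarrow> enat) set)"
    by (simp add: euclidean_product_topology compact_space_def)
  moreover have "closed incr_seqs"
    unfolding incr_seqs_eq
    by (intro closed_Collect_all closed_Collect_le continuous_on_add continuous_on_const
      continuous_on_product_coordinates)
  ultimately show ?thesis
    using closed_compactin[of euclidean UNIV incr_seqs] by simp
qed

lemma incr_seqs_infinity_in_Q_seqs:
  assumes f: "f \<in> incr_seqs" "f n = \<infinity>"
  shows "f \<in> Q_seqs"
proof -
  define k where "k = (LEAST n. f n = \<infinity>)"
  have k: "f k = \<infinity>" unfolding k_def using f(2) by (rule LeastI)
  have fin: "f i \<noteq> \<infinity>" if "i < k" for i using that not_less_Least unfolding k_def by blast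
  have mono: "mono f" and step: "\<And>n. f n < \<infinity> \<Longrightarrow> f n < f (Suc n)"
    using f(1) unfolding incr_seqs_def by auto
  have inf: "f i = \<infinity>" if "k \<le> i" for i
    using monoD[OF mono that] k by simp
  define s where "s = map (\<lambda>i. the_enat (f i)) [0..<k]"
  have lt: "f i < f j" if "i < j" "j < k" for i j
  proof -
    have "f i < f (Suc i)" using step fin[of i] that by simp
    also have "\<dots> \<le> f j" using monoD[OF mono] that by simp
    finally show ?thesis .
  qed
  have "the_enat (f i) < the_enat (f j)" if "i < j" "j < k" for i j
    using lt[OF that] fin[of i] fin[of j] that by (cases "f i"; cases "f j") auto
  then have "sorted_wrt (<) s" unfolding s_def sorted_wrt_iff_nth_less by simp
  moreover have enat_fin: "f i = enat (the_enat (f i))" if "i < k" for i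
    using fin[OF that] by auto
  then have "f = q_seq s"
    using enat_fin inf by (auto simp: fun_eq_iff q_seq_def s_def)
  ultimately show ?thesis unfolding Q_seqs_def by blast
qed

lemma Q_seqs_subset_incr_seqs: "Q_seqs \<subseteq> incr_seqs"
proof -
  have "q_seq s n + 1 \<le> q_seq s (Suc n)" if "sorted_wrt (<) s" for s n
    using that by (auto simp: q_seq_def sorted_wrt_iff_nth_less one_enat_def Suc_le_eq)
  then show ?thesis unfolding Q_seqs_def incr_seqs_eq by blast
qed

lemma countable_Q_seqs: "countable Q_seqs"
  unfolding Q_seqs_def by simp

lemma Q_seqs_eventually_infinity:
  assumes "f \<in> Q_seqs"
  shows "\<forall>\<^sub>F n in sequentially. f n = \<infinity>"
  proof -
  obtain s where "f = q_seq s" using assms unfolding Q_seqs_def by blast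
  then have "\<forall>n\<ge>length s. f n = \<infinity>" by (simp add: q_seq_def)
  then show ?thesis unfolding eventually_sequentially by blast
qed

section \<open>Compactness: open sets around the rational points and covers of powers\<close>

lemma compactin_subset_incseq:
  assumes "compactin X K" "\<And>m. openin X (G m)" "incseq G" "K \<subseteq> (\<Union>m. G m)"
  shows "\<exists>m :: nat. K \<subseteq> G m"
proof -
  obtain \<F> where \<F>: "finite \<F>" "\<F> \<subseteq> range G" "K \<subseteq> \<Union>\<F>"
    using assms unfolding compactin_def by (metis (no_types, lifting) image_iff)
  then obtain M where M: "finite M" "\<F> = G ` M" by (meson finite_subset_image)
  obtain m where "\<forall>i\<in>M. i \<le> m" using M(1) finite_nat_set_iff_bounded_le by auto
  then have "\<Union>\<F> \<subseteq> G m" using M(2) assms(3) by (auto dest: incseqD)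
  with \<F>(3) show ?thesis by blast
qed

lemma open_coordinate_le: "open {x :: nat \<Rightarrow> enat. x n \<le> enat m}"
proof -
  have "{x :: nat \<Rightarrow> enat. x n \<le> enat m} = {x. x n < enat (Suc m)}"
    proof (intro Collect_cong)
    fix x :: "nat \<Rightarrow> enat"
    show "x n \<le> enat m \<longleftrightarrow> x n < enat (Suc m)" by (cases "x n") auto
  qed
  also have "open \<dots>"
    by (intro open_Collect_less continuous_on_const continuous_on_product_coordinates)
  finally show ?thesis .
qed

text \<open>The sets \<open>G \<union> {x. x n \<le> enat m}\<close> increase with \<open>m\<close>
  and cover the compact space, because a point with \<open>x n = \<infinity>\<close> lies in
  \<open>Q_seqs\<close>.\<close>

lemma open_superset_Q_seqs:
  assumes "open G" "Q_seqs \<subseteq> G"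
  shows "\<exists>g. \<forall>x\<in>incr_seqs. enat g < x n \<longrightarrow> x \<in> G"
proof -
  have "\<exists>m. incr_seqs \<subseteq> G \<union> {x. x n \<le> enat m}"
  proof (rule compactin_subset_incseq[OF compactin_incr_seqs])
    show "openin euclidean (G \<union> {x. x n \<le> enat m})" for m
      using assms(1) open_coordinate_le by (auto intro: open_Un)
    show "incseq (\<lambda>m. G \<union> {x. x n \<le> enat m})"
      by (auto simp: incseq_def) (meson enat_ord_simps(1) order_trans)
    show "incr_seqs \<subseteq> (\<Union>m. G \<union> {x. x n \<le> enat m})"
    proof
      fix x assume x: "x \<in> incr_seqs"
      show "x \<in> (\<Union>m. G \<union> {x. x n \<le> enat m})"
        using incr_seqs_infinity_in_Q_seqs[OF x, of n] assms(2) by (cases "x n") auto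
    qed
  qed
  then obtain m where m: "incr_seqs \<subseteq> G \<union> {x. x n \<le> enat m}" ..
  have "x \<in> G" if "x \<in> incr_seqs" "enat m < x n" for x
    using subsetD[OF m that(1)] that(2) by auto
  then show ?thesis by blast
qed

text \<open>The same compactness argument in a power: a tuple whose \<open>n\<close>-th entries are
  all infinite consists of rational points, hence is covered by some \<open>Z m\<close>. As
  everything increases, one number serves both as threshold and as index.\<close>

lemma power_incseq_open_cover:
  assumes H: "Q_seqs \<subseteq> H" "H \<subseteq> incr_seqs"
    and Z: "\<And>m. openin (product_topology (\<lambda>_. top_of_set H) I) (Z m)" "incseq Z"
      "topspace (product_topology (\<lambda>_. top_of_set H) I) \<subseteq> (\<Union>m. Z m)"
  shows "\<exists>g. \<forall>x \<in> PiE I (\<lambda>_. H). (\<forall>i\<in>I. enat g < x i n) \<longrightarrow> x \<in> Z g"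
proof -
  let ?P = "product_topology (\<lambda>_. euclidean :: (nat \<Rightarrow> enat) topology) I"
  have "openin (subtopology ?P (PiE I (\<lambda>_. H))) (Z m)" for m
    using Z(1) by (simp add: subtopology_product_topology)
  then have "\<forall>m. \<exists>T. openin ?P T \<and> Z m = T \<inter> PiE I (\<lambda>_. H)" unfolding openin_subtopology by blast
  then obtain T where T: "\<And>m. openin ?P (T m)" "\<And>m. Z m = T m \<inter> PiE I (\<lambda>_. H)" by metis
  define L where "L m = {x \<in> topspace ?P. \<exists>i\<in>I. x i n \<le> enat m}" for m
  \<comment> \<open>The ambient extensions \<open>T\<close> of the increasing sets \<open>Z\<close>
    need not increase, hence the union; \<open>L m\<close> absorbs the tuples with a small
    entry.\<close>
  define G where "G m = (\<Union>j\<le>m. T j) \<union> L m" for m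
  have cover: "PiE I (\<lambda>_. H) \<subseteq> (\<Union>m. Z m)" using Z(3) by simp
  have L: "openin ?P (L m)" for m
  proof -
    have "L m = (\<Union>i\<in>I. {x \<in> topspace ?P. x i \<in> {y. y n \<le> enat m}})" unfolding L_def by auto
    also have "openin ?P \<dots>"
    proof (intro openin_Union, clarify)
      fix i assume "i \<in> I"
      then show "openin ?P {x \<in> topspace ?P. x i \<in> {y. y n \<le> enat m}}"
        using open_coordinate_le
        by (intro openin_continuous_map_preimage[OF continuous_map_product_projection]) auto
    qed
    finally show ?thesis .
  qed
  have "\<exists>m. PiE I (\<lambda>_. incr_seqs) \<subseteq> G m"
  proof (rule compactin_subset_incseq)
    show "compactin ?P (PiE I (\<lambda>_. incr_seqs))"
      using compactin_incr_seqs by (simp add: compactin_PiE)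
    show "openin ?P (G m)" for m
      unfolding G_def using T L by (blast intro: openin_Un openin_Union)
    have "L m \<subseteq> L k" if "m \<le> k" for m k
      using that unfolding L_def by auto (meson enat_ord_simps(1) order_trans)
    then show "incseq G" unfolding G_def incseq_def by (blast intro: order_trans)
    show "PiE I (\<lambda>_. incr_seqs) \<subseteq> (\<Union>m. G m)"
    proof
      fix x assume x: "x \<in> PiE I (\<lambda>_. incr_seqs)"
      show "x \<in> (\<Union>m. G m)"
      proof (cases "\<exists>i\<in>I. x i n \<noteq> \<infinity>")
        case True
        then obtain i m where "i \<in> I" "x i n = enat m" by auto
        then have "x \<in> L m" using x unfolding L_def by (auto simp: PiE_iff intro!: bexI[of _ i])
        then show ?thesis unfolding G_def by blast
      next
        case False
        then have "x \<in> PiE I (\<lambda>_. H)"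
          using x incr_seqs_infinity_in_Q_seqs[of _ n] H(1) unfolding PiE_iff by blast
        then obtain m where "x \<in> Z m" using cover by blast
        then have "x \<in> G m" using T(2)[of m] unfolding G_def by auto
        then show ?thesis by blast
      qed
    qed
  qed
  then obtain m where m: "PiE I (\<lambda>_. incr_seqs) \<subseteq> G m" by blast
  have "x \<in> Z m" if x: "x \<in> PiE I (\<lambda>_. H)" "\<forall>i\<in>I. enat m < x i n" for x
  proof -
    have "x \<in> PiE I (\<lambda>_. incr_seqs)" using x(1) H(2) by (auto simp: PiE_iff)
    then have "x \<in> G m" using m by blast
    moreover have "x \<notin> L m" using x(2) unfolding L_def by (auto simp: not_le)
    ultimately obtain j where "j \<le> m" "x \<in> T j" unfolding G_def by blast
    then show ?thesis using T(2) x(1) incseqD[OF Z(2)] by blast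
  qed
  then show ?thesis by blast
qed

section \<open>Covering properties of the scale with the rational points\<close>

lemma UfinD:
  assumes "Ufin \<A> \<B> X" "\<And>n. U n \<in> \<A> X"
    and "\<And>n. \<not> (\<exists>F. finite F \<and> F \<subseteq> U n \<and> topspace X \<subseteq> \<Union>F)"
  shows "\<exists>F. (\<forall>n :: nat. finite (F n) \<and> F n \<subseteq> U n) \<and> range (\<lambda>n. \<Union>(F n)) \<in> \<B> X"
  using assms unfolding Ufin_def by simp

text \<open>The Hurewicz property, phrased with increasing covers so that it passes to preimages.\<close>

definition increasing_covers_bounded :: "'a topology \<Rightarrow> bool" where
  "increasing_covers_bounded X \<longleftrightarrow> (\<forall>W :: nat \<Rightarrow> nat \<Rightarrow> 'a set.
     (\<forall>n m. openin X (W n m)) \<and> (\<forall>n. incseq (W n)) \<and> (\<forall>n. topspace X \<subseteq> (\<Union>m. W n m)) \<longrightarrow>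
     (\<exists>h. \<forall>x\<in>topspace X. \<forall>\<^sub>F n in sequentially. x \<in> W n (h n)))"

lemma increasing_covers_boundedD:
  assumes "increasing_covers_bounded X" "\<And>n m. openin X (W n m)" "\<And>n. incseq (W n)"
    and "\<And>n. topspace X \<subseteq> (\<Union>m. W n m)"
  shows "\<exists>h. \<forall>x\<in>topspace X. \<forall>\<^sub>F n in sequentially. x \<in> W n (h n)"
  using assms unfolding increasing_covers_bounded_def by simp

text \<open>Enumerating each cover and uniting its initial segments gives increasing covers; a bound
  \<open>h\<close> for these tells how long an initial segment to select.\<close>

lemma Ufin_gamma_gamma_if_increasing_covers_bounded:
  assumes "increasing_covers_bounded X"
  shows "Ufin \<Gamma> \<Gamma> X"
  unfolding Ufin_def
proof (intro allI impI)
  fix U :: "nat \<Rightarrow> 'a set set"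
  assume U: "\<forall>n. U n \<in> \<Gamma> X \<and> \<not> (\<exists>F. finite F \<and> F \<subseteq> U n \<and> topspace X \<subseteq> \<Union>F)"
  define e where "e n = from_nat_into (U n)" for n
  have Un: "countable (U n)" "infinite (U n)" "\<And>V. V \<in> U n \<Longrightarrow> openin X V" "topspace X \<subseteq> \<Union>(U n)" for n
    using U unfolding gamma_covers_def open_covers_def by auto
  have ran: "range (e n) = U n" for n
    using Un(1,2)[of n] unfolding e_def by (metis finite.emptyI range_from_nat_into)
  define W where "W n m = (\<Union>i\<le>m. e n i)" for n m
  have "openin X (W n m)" for n m
    using Un(3) ran unfolding W_def by blast
  moreover have "incseq (W n)" for n
    unfolding W_def incseq_def by fastforce
  moreover have "topspace X \<subseteq> (\<Union>m. W n m)" for n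
  proof
    fix x assume "x \<in> topspace X"
    then obtain V where "V \<in> U n" "x \<in> V" using Un(4) by blast
    then obtain i where "x \<in> e n i" using ran[of n] by (metis imageE)
    then show "x \<in> (\<Union>m. W n m)" unfolding W_def by auto
  qed
  ultimately obtain h where h: "\<And>x. x \<in> topspace X \<Longrightarrow> \<forall>\<^sub>F n in sequentially. x \<in> W n (h n)"
    using increasing_covers_boundedD[OF assms] by metis
  define F where "F n = e n ` {..h n}" for n
  have UF: "\<Union>(F n) = W n (h n)" for n unfolding F_def W_def ..
  have F: "finite (F n)" "F n \<subseteq> U n" for n using ran[of n] unfolding F_def by auto
  have not_cover: "\<not> topspace X \<subseteq> \<Union>(F n)" for n using U F by blast
  have fin: "finite {n. x \<notin> \<Union>(F n)}" if "x \<in> topspace X" for x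
    using h[OF that] unfolding UF cofinite_eq_sequentially[symmetric] eventually_cofinite .
  \<comment> \<open>A value repeated infinitely often would leave a point uncovered at infinitely
    many \<open>n\<close>, as no finite selection covers the space.\<close>
  have "infinite (range (\<lambda>n. \<Union>(F n)))"
  proof
    assume "finite (range (\<lambda>n. \<Union>(F n)))"
    then obtain k where k: "infinite {n. \<Union>(F n) = \<Union>(F k)}"
      using inf_img_fin_dom[of "\<lambda>n. \<Union>(F n)" UNIV] by (auto simp: vimage_def)
    obtain x where x: "x \<in> topspace X" "x \<notin> \<Union>(F k)" using not_cover[of k] by blast
    have "{n. \<Union>(F n) = \<Union>(F k)} \<subseteq> {n. x \<notin> \<Union>(F n)}" using x(2) by blast
    with k fin[OF x(1)] show False using finite_subset by blast
  qed
  moreover have "finite {V \<in> range (\<lambda>n. \<Union>(F n)). x \<notin> V}" if "x \<in> topspace X" for x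
    by (rule finite_subset[OF _ finite_imageI[OF fin[OF that], of "\<lambda>n. \<Union>(F n)"]]) auto
  moreover have "topspace X \<subseteq> \<Union>(range (\<lambda>n. \<Union>(F n)))"
  proof
    fix x assume "x \<in> topspace X"
    from fin[OF this] have "\<exists>n. n \<notin> {n. x \<notin> \<Union>(F n)}" using ex_new_if_finite infinite_UNIV_nat by blast
    then show "x \<in> \<Union>(range (\<lambda>n. \<Union>(F n)))" by blast
  qed
  moreover have "openin X (\<Union>(F n))" for n using F Un(3) by (meson openin_Union subsetD)
  ultimately have "range (\<lambda>n. \<Union>(F n)) \<in> \<Gamma> X"
    using not_cover unfolding gamma_covers_def open_covers_def by auto
  with F show "\<exists>F. (\<forall>n. finite (F n) \<and> F n \<subseteq> U n) \<and> range (\<lambda>n. \<Union>(F n)) \<in> \<Gamma> X" by blast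
qed

definition enat_seq :: "(nat \<Rightarrow> nat) \<Rightarrow> nat \<Rightarrow> enat" where
  "enat_seq f n = enat (f n)"

lemma enat_seq_notin_Q_seqs: "enat_seq f \<notin> Q_seqs"
  using Q_seqs_eventually_infinity[of "enat_seq f"] by (auto simp: enat_seq_def)

lemma inj_enat_seq: "inj enat_seq"
  by (auto simp: inj_def enat_seq_def fun_eq_iff)

context b_scale
begin

definition H :: "(nat \<Rightarrow> enat) set" where
  "H = enat_seq ` B \<union> Q_seqs"

lemma H_minus_Q_seqs: "H - Q_seqs = enat_seq ` B"
  unfolding H_def using enat_seq_notin_Q_seqs by blast

lemma H_subset_incr_seqs: "H \<subseteq> incr_seqs"
proof -
  have "enat_seq f n + 1 \<le> enat_seq f (Suc n)" if "f \<in> B" for f n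
    using strict_monoD[OF strict_mono[OF that], of n "Suc n"]
    by (simp add: enat_seq_def one_enat_def)
  then have "enat_seq ` B \<subseteq> incr_seqs" unfolding incr_seqs_eq by blast
  then show ?thesis unfolding H_def using Q_seqs_subset_incr_seqs by blast
qed

lemma bounded_image:
  assumes "|Y| <o |B|"
  shows "\<exists>h. \<forall>y\<in>Y. \<Psi> y \<le>\<^sup>* h"
  using small_bounded[OF ordLeq_ordLess_trans[OF card_of_image assms], of \<Psi>] by blast

lemma infinite_B: "infinite B"
  using unbounded bounded_family_if_countable[of B] countable_finite
  unfolding unbounded_family_def by blast

lemma card_H: "|H| =o |B|"
proof -
  have "|Q_seqs| \<le>o |UNIV :: nat set|"
    using countable_Q_seqs card_of_ordLeq unfolding countable_def by blast
  moreover have "|UNIV :: nat set| \<le>o |B|"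
    using infinite_B infinite_iff_card_of_nat by blast
  ultimately have "|Q_seqs| \<le>o |B|" using ordLeq_transitive by blast
  then have "|H| \<le>o |B|"
    unfolding H_def using infinite_B card_of_image card_of_Card_order
    by (intro card_of_Un_ordLeq_infinite_Field) (auto simp: Field_card_of)
  moreover have "|B| \<le>o |H|"
    by (rule card_of_ordLeqI[of enat_seq]) (auto simp: H_def intro: inj_on_subset[OF inj_enat_seq])
  ultimately show ?thesis by (simp add: ordIso_iff_ordLeq)
qed

text \<open>The induction runs over finite index sets, so that freezing coordinate \<open>i\<close>
  leads directly to the power over \<open>I - {i}\<close>.\<close>

lemma increasing_covers_bounded_power_H:
  assumes "finite I"
  shows "increasing_covers_bounded (product_topology (\<lambda>_. top_of_set H) I)"
  using assms
proof (induction I rule: finite_psubset_induct)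
  case (psubset I)
  let ?P = "\<lambda>I. product_topology (\<lambda>_. top_of_set H) I"
  show ?case
    unfolding increasing_covers_bounded_def
  proof (intro allI impI)
    fix W :: "nat \<Rightarrow> nat \<Rightarrow> ('a \<Rightarrow> nat \<Rightarrow> enat) set"
    assume "(\<forall>n m. openin (?P I) (W n m)) \<and> (\<forall>n. incseq (W n)) \<and> (\<forall>n. topspace (?P I) \<subseteq> (\<Union>m. W n m))"
    then have W: "\<And>n m. openin (?P I) (W n m)" "\<And>n. incseq (W n)" "\<And>n. topspace (?P I) \<subseteq> (\<Union>m. W n m)"
      by blast+
    \<comment> \<open>Intersecting the earlier covers lets membership at a later index
      \<open>nxt n\<close> yield membership at \<open>n\<close>.\<close>
    define W' where "W' n m = (\<Inter>j\<le>n. W j m)" for n m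
    have "\<exists>g. \<forall>x \<in> PiE I (\<lambda>_. H). (\<forall>i\<in>I. enat g < x i n) \<longrightarrow> x \<in> W' n g" for n
    proof (rule power_incseq_open_cover[OF _ H_subset_incr_seqs])
      show "Q_seqs \<subseteq> H" unfolding H_def by blast
      show "openin (?P I) (W' n m)" for m
        unfolding W'_def using W(1) by (intro openin_INT2) auto
      show "incseq (W' n)"
        using W(2) unfolding W'_def incseq_def by blast
      show "topspace (?P I) \<subseteq> (\<Union>m. W' n m)"
      proof
        fix x assume "x \<in> topspace (?P I)"
        then have "\<forall>j. \<exists>m. x \<in> W j m" using W(3) by blast
        then obtain m where m: "\<And>j. x \<in> W j (m j)" by metis
        have "x \<in> W j (Max (m ` {..n}))" if "j \<le> n" for j
          using incseqD[OF W(2), of "m j" "Max (m ` {..n})" j] m that by auto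
        then show "x \<in> (\<Union>m. W' n m)" unfolding W'_def by blast
      qed
    qed
    then obtain g where g: "\<And>n x. x \<in> PiE I (\<lambda>_. H) \<Longrightarrow> \<forall>i\<in>I. enat (g n) < x i n \<Longrightarrow> x \<in> W' n (g n)"
      by metis
    obtain f0 where f0: "f0 \<in> B" "\<not> f0 \<le>\<^sup>* g"
      using unbounded unfolding unbounded_family_def by blast
    have "\<exists>m. g m < f0 m \<and> n \<le> m" for n
      using f0(2) unfolding eventually_le_def eventually_sequentially by (auto simp: not_le)
    then obtain nxt where nxt: "\<And>n. g (nxt n) < f0 (nxt n)" "\<And>n. n \<le> nxt n" by metis
    \<comment> \<open>An initial segment of the scale, hence fewer than \<open>|B|\<close>
      functions; each gives a section handled by the induction hypothesis, and the resulting bounds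
      have a common bound \<open>k i\<close>.\<close>
    define Y where "Y = {f \<in> B. f \<le>\<^sup>* f0}"
    have "\<exists>h. \<forall>z \<in> PiE (I - {i}) (\<lambda>_. H). \<forall>\<^sub>F n in sequentially. z(i := enat_seq y) \<in> W n (h n)"
      if i: "i \<in> I" and y: "y \<in> Y" for i y
    proof -
      let ?\<phi> = "\<lambda>z. z(i := enat_seq y)"
      have yH: "enat_seq y \<in> H" using y unfolding Y_def H_def by blast
      have cont: "continuous_map (?P (I - {i})) (?P I) ?\<phi>"
        unfolding continuous_map_componentwise
      proof (intro conjI ballI)
        show "?\<phi> ` topspace (?P (I - {i})) \<subseteq> extensional I"
          using i by (auto simp: PiE_iff extensional_def)
        show "continuous_map (?P (I - {i})) (top_of_set H) (\<lambda>z. ?\<phi> z j)" if "j \<in> I" for j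
          using that yH continuous_map_product_projection[of j "I - {i}" "\<lambda>_. top_of_set H"]
          by (cases "j = i") auto
      qed
      define W2 where "W2 n m = {z \<in> topspace (?P (I - {i})). ?\<phi> z \<in> W n m}" for n m
      have "increasing_covers_bounded (?P (I - {i}))" using psubset.IH i by blast
      moreover have "openin (?P (I - {i})) (W2 n m)" for n m
        unfolding W2_def using cont W(1) by (rule openin_continuous_map_preimage)
      moreover have "incseq (W2 n)" for n
        using W(2)[of n] unfolding W2_def incseq_def by blast
      moreover have "topspace (?P (I - {i})) \<subseteq> (\<Union>m. W2 n m)" for n
        using W(3)[of n] continuous_map_image_subset_topspace[OF cont] unfolding W2_def by blast
      ultimately obtain h where "\<forall>z\<in>topspace (?P (I - {i})). \<forall>\<^sub>F n in sequentially. z \<in> W2 n (h n)"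
        using increasing_covers_boundedD[of "?P (I - {i})" W2] by blast
      then show ?thesis
        unfolding W2_def by (intro exI[of _ h]) (auto elim!: eventually_mono)
    qed
    then obtain h where h: "\<And>i y z. i \<in> I \<Longrightarrow> y \<in> Y \<Longrightarrow> z \<in> PiE (I - {i}) (\<lambda>_. H) \<Longrightarrow>
        \<forall>\<^sub>F n in sequentially. z(i := enat_seq y) \<in> W n (h i y n)"
      by metis
    have "\<exists>k. \<forall>y\<in>Y. h i y \<le>\<^sup>* k" for i
      using bounded_image card_below unfolding Y_def by blast
    then obtain k where k: "\<And>i y. y \<in> Y \<Longrightarrow> h i y \<le>\<^sup>* k i" by metis
    \<comment> \<open>The first summand serves tuples whose entries all avoid \<open>Y\<close>, the
      sum those with some entry \<open>i\<close> in \<open>Y\<close>.\<close>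
    define b where "b n = g (nxt n) + (\<Sum>i\<in>I. k i n)" for n
    have "\<forall>\<^sub>F n in sequentially. x \<in> W n (b n)" if x: "x \<in> PiE I (\<lambda>_. H)" for x
    proof (cases "\<exists>i\<in>I. \<exists>y\<in>Y. x i = enat_seq y")
      case True
      then obtain i y where i: "i \<in> I" "y \<in> Y" "x i = enat_seq y" by blast
      define z where "z = restrict x (I - {i})"
      have z: "z \<in> PiE (I - {i}) (\<lambda>_. H)" using x unfolding z_def by auto
      have xz: "x = z(i := enat_seq y)"
        using x i unfolding z_def by (auto simp: fun_eq_iff PiE_iff extensional_def)
      have le: "k i n \<le> b n" for n
        using member_le_sum[of i I "\<lambda>i. k i n"] i(1) psubset.hyps(1) unfolding b_def by simp
      have "\<forall>\<^sub>F n in sequentially. h i y n \<le> k i n" using k[OF i(2)] unfolding eventually_le_def .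
      with h[OF i(1,2) z] show ?thesis
      proof eventually_elim
        case (elim n)
        then have "x \<in> W n (h i y n)" "h i y n \<le> b n" using xz le[of n] by auto
        then show ?case using incseqD[OF W(2)] by blast
      qed
    next
      case False
      \<comment> \<open>Rational entries are eventually infinite; the others lie outside
        \<open>Y\<close>, so linearity puts them above \<open>f0\<close>.\<close>
      have "\<forall>\<^sub>F n in sequentially. enat (f0 n) \<le> x i n" if i: "i \<in> I" for i
      proof (cases "x i \<in> Q_seqs")
        case True
        from Q_seqs_eventually_infinity[OF this] show ?thesis by eventually_elim simp
      next
        case 2: False
        have "x i \<in> H" using x i by auto
        with 2 obtain f where f: "f \<in> B" "x i = enat_seq f" unfolding H_def by blast
        with False i have "f \<notin> Y" by blast
        with f f0 linear have "f0 \<le>\<^sup>* f" unfolding Y_def by blast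
        then show ?thesis unfolding eventually_le_def f by (simp add: enat_seq_def)
      qed
      then have "\<forall>\<^sub>F n in sequentially. \<forall>i\<in>I. enat (f0 n) \<le> x i n"
        using psubset.hyps(1) by (intro eventually_ball_finite) auto
      then obtain N where N: "\<And>n i. N \<le> n \<Longrightarrow> i \<in> I \<Longrightarrow> enat (f0 n) \<le> x i n"
        unfolding eventually_sequentially by blast
      have "x \<in> W n (b n)" if "N \<le> n" for n
      proof -
        have "enat (g (nxt n)) < x i (nxt n)" if "i \<in> I" for i
          using N[OF order_trans[OF \<open>N \<le> n\<close> nxt(2)] that] nxt(1)[of n]
          by (meson enat_ord_simps(2) less_le_trans)
        then have "x \<in> W' (nxt n) (g (nxt n))" using g[OF x] by blast
        then have "x \<in> W n (g (nxt n))" using nxt(2)[of n] unfolding W'_def by blast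
        then show ?thesis using incseqD[OF W(2), of "g (nxt n)" "b n" n] unfolding b_def by auto
      qed
      then show ?thesis unfolding eventually_sequentially by blast
    qed
    then show "\<exists>h. \<forall>x\<in>topspace (?P I). \<forall>\<^sub>F n in sequentially. x \<in> W n (h n)" by auto
  qed
qed

text \<open>The even-numbered covers are spent on the countable set \<open>Q_seqs\<close>. The
  chosen sets already cover all but fewer than \<open>|B|\<close> further points, for which the
  odd-numbered covers remain.\<close>

lemma S1_gamma_open_H: "S1 \<Gamma> \<O> (top_of_set H)"
  unfolding S1_def
proof (intro allI impI)
  fix U :: "nat \<Rightarrow> (nat \<Rightarrow> enat) set set"
  assume U: "\<forall>n. U n \<in> \<Gamma> (top_of_set H)"
  have Un: "countable (U n)" "infinite (U n)" "\<And>V. V \<in> U n \<Longrightarrow> openin (top_of_set H) V"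
      "H \<subseteq> \<Union>(U n)" "\<And>x. x \<in> H \<Longrightarrow> finite {V \<in> U n. x \<notin> V}" for n
    using U unfolding gamma_covers_def open_covers_def by auto
  define q where "q = from_nat_into Q_seqs"
  have "q_seq [] \<in> Q_seqs" unfolding Q_seqs_def by simp
  then have q: "range q = Q_seqs"
    unfolding q_def using countable_Q_seqs by (metis empty_iff range_from_nat_into)
  have "\<exists>V. V \<in> U (2 * n) \<and> q n \<in> V" for n
    using Un(4)[of "2 * n"] q unfolding H_def by blast
  then obtain V0 where V0: "\<And>n. V0 n \<in> U (2 * n)" "\<And>n. q n \<in> V0 n" by metis
  have "openin (top_of_set H) (\<Union>n. V0 n)" using V0(1) Un(3) by blast
  then obtain G where G: "open G" "(\<Union>n. V0 n) = H \<inter> G" unfolding openin_open by blast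
  have "q n \<in> G" for n using V0(2)[of n] G(2) by auto
  then have "Q_seqs \<subseteq> G" using q by (metis image_subsetI)
  then have "\<exists>g. \<forall>x\<in>incr_seqs. enat g < x n \<longrightarrow> x \<in> G" for n
    using open_superset_Q_seqs G(1) by blast
  then obtain g where g: "\<And>n x. x \<in> incr_seqs \<Longrightarrow> enat (g n) < x n \<Longrightarrow> x \<in> G" by metis
  define Y where "Y = {f \<in> B. f \<le>\<^sup>* g}"
  have notY: "enat_seq f \<in> (\<Union>n. V0 n)" if f: "f \<in> B" "f \<notin> Y" for f
  proof -
    obtain n where "g n < f n"
      using f unfolding Y_def eventually_le_def by (auto simp: not_le dest: not_eventuallyD)
    moreover have "enat_seq f \<in> H" using f unfolding H_def by blast
    ultimately show ?thesis
      using g[of "enat_seq f" n] G(2) H_subset_incr_seqs by (auto simp: enat_seq_def)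
  qed
  define e where "e n = from_nat_into (U (Suc (2 * n)))" for n
  have e: "bij_betw (e n) UNIV (U (Suc (2 * n)))" for n
    unfolding e_def using Un(1,2) by (rule bij_betw_from_nat_into)
  \<comment> \<open>The \<open>\<gamma>\<close>-property with an injective enumeration: every point
    is in all late members, so each \<open>f\<close> in \<open>Y\<close> has a rate function
    \<open>\<Psi> f\<close>, and a common bound of the rates selects the odd members.\<close>
  have "\<exists>m. \<forall>k\<ge>m. enat_seq f \<in> e n k" if f: "f \<in> Y" for f n
  proof -
    have "enat_seq f \<in> H" using f unfolding Y_def H_def by blast
    from finite_vimageI[OF Un(5)[OF this, of "Suc (2 * n)"] bij_betw_imp_inj_on[OF e[of n]]]
    have "finite {k. enat_seq f \<notin> e n k}"
      using bij_betwE[OF e[of n]] by (simp add: vimage_def)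
    then have "\<forall>\<^sub>F k in sequentially. enat_seq f \<in> e n k"
      unfolding cofinite_eq_sequentially[symmetric] eventually_cofinite .
    then show ?thesis unfolding eventually_sequentially .
  qed
  then obtain \<Psi> where \<Psi>: "\<And>f n k. f \<in> Y \<Longrightarrow> \<Psi> f n \<le> k \<Longrightarrow> enat_seq f \<in> e n k" by metis
  obtain h where h: "\<And>f. f \<in> Y \<Longrightarrow> \<Psi> f \<le>\<^sup>* h"
    using bounded_image[OF card_below[of g], of \<Psi>] unfolding Y_def by blast
  define V where "V n = (if even n then V0 (n div 2) else e (n div 2) (h (n div 2)))" for n
  have VU: "V n \<in> U n" for n
  proof (cases "even n")
    case True
    then show ?thesis using V0(1)[of "n div 2"] unfolding V_def by simp
  next
    case False
    then have "Suc (2 * (n div 2)) = n" by simp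
    then show ?thesis using False bij_betwE[OF e[of "n div 2"]] unfolding V_def by simp
  qed
  have V_even: "V0 n = V (2 * n)" and V_odd: "e n (h n) = V (Suc (2 * n))" for n
    unfolding V_def by simp_all
  have "H \<subseteq> (\<Union>n. V n)"
  proof
    fix x assume "x \<in> H"
    then consider "x \<in> Q_seqs" | f where "f \<in> B" "x = enat_seq f" "f \<notin> Y" | f where "f \<in> Y" "x = enat_seq f"
      unfolding H_def by blast
    then show "x \<in> (\<Union>n. V n)"
    proof cases
      case 1
      then obtain n where "x = q n" using q by blast
      then show ?thesis using V0(2) V_even by blast
    next
      case 2
      then show ?thesis using notY V_even by blast
    next
      case 3
      obtain n where "\<Psi> f n \<le> h n"
        using h[OF 3(1)] unfolding eventually_le_def eventually_sequentially by blast
      then show ?thesis using \<Psi>[OF 3(1)] 3(2) V_odd by blast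
    qed
  qed
  then have "range V \<in> \<O> (top_of_set H)"
    using VU Un(3) unfolding open_covers_def by auto
  with VU show "\<exists>V. (\<forall>n. V n \<in> U n) \<and> range V \<in> \<O> (top_of_set H)" by blast
qed

section \<open>Failure of \<open>\<sigma>\<close>-compactness\<close>

lemma not_sigma_compact_H: "\<not> sigma_compact H"
proof
  assume "sigma_compact H"
  then obtain K :: "nat \<Rightarrow> (nat \<Rightarrow> enat) set" where K: "\<And>n. compact (K n)" "H = (\<Union>n. K n)"
    unfolding sigma_compact_def by blast
  \<comment> \<open>The sets whose scale part is bounded form a \<open>\<sigma>\<close>-ideal;
    rational points are ignored.\<close>
  define bdd where "bdd S \<longleftrightarrow> (\<exists>g. \<forall>f\<in>B. enat_seq f \<in> S \<longrightarrow> f \<le>\<^sup>* g)" for S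
  have bdd_subset: "bdd S" if "bdd T" "S \<subseteq> T" for S T using that unfolding bdd_def by blast
  have bdd_Union: "bdd (\<Union>\<S>)" if "countable \<S>" "\<And>S. S \<in> \<S> \<Longrightarrow> bdd S" for \<S>
  proof -
    obtain G where G: "\<And>S f. S \<in> \<S> \<Longrightarrow> f \<in> B \<Longrightarrow> enat_seq f \<in> S \<Longrightarrow> f \<le>\<^sup>* G S"
      using \<open>\<And>S. S \<in> \<S> \<Longrightarrow> bdd S\<close> unfolding bdd_def by metis
    obtain g where "\<forall>f\<in>G ` \<S>. f \<le>\<^sup>* g"
      using bounded_family_if_countable[of "G ` \<S>"] \<open>countable \<S>\<close> by blast
    then have "\<forall>f\<in>B. enat_seq f \<in> \<Union>\<S> \<longrightarrow> f \<le>\<^sup>* g"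
      using G eventually_le_trans by (metis UnionE imageI)
    then show ?thesis unfolding bdd_def by blast
  qed
  have "\<not> bdd H" using unbounded unfolding unbounded_family_def bdd_def H_def by blast
  then obtain k where k: "\<not> bdd (K k)" using bdd_Union[of "range K"] K(2) by auto
  obtain \<B> :: "(nat \<Rightarrow> enat) set set" where \<B>: "countable \<B>" "topological_basis \<B>"
    using ex_countable_basis by blast
  \<comment> \<open>As in the Cantor-Bendixson argument, deleting all basic open sets with bounded
    trace removes only a bounded part and leaves a kernel \<open>P\<close> that is nowhere locally
    bounded.\<close>
  define R where "R = {V \<in> \<B>. bdd (V \<inter> K k)}"
  define P where "P = K k - \<Union>R"
  have "open (\<Union>R)" using topological_basis_open[OF \<B>(2)] unfolding R_def by blast
  then have P: "compact P" unfolding P_def using K(1) by (rule compact_diff[rotated])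
  have "bdd (\<Union>((\<lambda>V. V \<inter> K k) ` R))"
    using \<B>(1) by (intro bdd_Union) (auto simp: R_def intro: countable_subset)
  then have bddR: "bdd (\<Union>R \<inter> K k)" by (rule bdd_subset) blast
  have bdd_Un: "bdd (S \<union> T)" if "bdd S" "bdd T" for S T
    using bdd_Union[of "{S, T}"] that by auto
  have unbP: "\<not> bdd (V \<inter> P)" if V: "open V" "V \<inter> P \<noteq> {}" for V
  proof
    assume bd: "bdd (V \<inter> P)"
    obtain x where x: "x \<in> V" "x \<in> P" using V by blast
    obtain V' where V': "V' \<in> \<B>" "x \<in> V'" "V' \<subseteq> V"
      using topological_basisE[OF \<B>(2) V(1) x(1)] by blast
    \<comment> \<open>A bounded trace on \<open>P\<close> would make the trace on \<open>K k\<close>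
      bounded, so \<open>V'\<close> would have been deleted, although it contains a point of
      \<open>P\<close>.\<close>
    have "V' \<inter> K k \<subseteq> (V \<inter> P) \<union> (\<Union>R \<inter> K k)" using V'(3) unfolding P_def by blast
    then have "bdd (V' \<inter> K k)" using bdd_Un[OF bd bddR] bdd_subset by blast
    then have "V' \<in> R" using V' unfolding R_def by blast
    then show False using x V' unfolding P_def by blast
  qed
  have notbddP: "\<not> bdd P"
  proof
    assume "bdd P"
    then have "bdd (P \<union> (\<Union>R \<inter> K k))" using bdd_Un bddR by blast
    then have "bdd (K k)" by (rule bdd_subset) (auto simp: P_def)
    then show False using k by blast
  qed
  have "\<exists>d. d \<in> B \<and> enat_seq d \<in> V \<inter> P" if "V \<in> \<B>" "V \<inter> P \<noteq> {}" for V
    using unbP[OF topological_basis_open[OF \<B>(2) that(1)] that(2)] unfolding bdd_def by blast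
  \<comment> \<open>One scale point in each basic open set that meets \<open>P\<close>: a countable
    dense subset of \<open>P\<close>, bounded by \<open>g\<close> below.\<close>
  then obtain d where d: "\<And>V. V \<in> \<B> \<Longrightarrow> V \<inter> P \<noteq> {} \<Longrightarrow> d V \<in> B \<and> enat_seq (d V) \<in> V \<inter> P"
    by metis
  obtain g where g: "\<forall>f\<in>d ` \<B>. f \<le>\<^sup>* g"
    using bounded_family_if_countable[of "d ` \<B>"] \<B>(1) by blast
  obtain x where x: "x \<in> B" "enat_seq x \<in> P" "\<not> x \<le>\<^sup>* g"
    using notbddP unfolding bdd_def by blast
  define X where "X = top_of_set P"
  \<comment> \<open>A point in all \<open>G n\<close> and all \<open>L n\<close> is infinitely often
    above and infinitely often below \<open>x\<close>; Baire category provides one.\<close>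
  define G where "G n = {y \<in> P. \<exists>m\<ge>n. enat (x m) < y m}" for n
  define L where "L n = {y \<in> P. \<exists>m\<ge>n. y m < enat (x m)}" for n
  have openG: "openin X (G n)" for n
  proof -
    have "G n = P \<inter> (\<Union>m\<in>{n..}. {y. enat (x m) < y m})" unfolding G_def by auto
    moreover have "open (\<Union>m\<in>{n..}. {y :: nat \<Rightarrow> enat. enat (x m) < y m})"
      by (intro open_UN ballI open_Collect_less continuous_on_const continuous_on_product_coordinates)
    ultimately show ?thesis unfolding X_def openin_open by blast
  qed
  have openL: "openin X (L n)" for n
  proof -
    have "L n = P \<inter> (\<Union>m\<in>{n..}. {y. y m < enat (x m)})" unfolding L_def by auto
    moreover have "open (\<Union>m\<in>{n..}. {y :: nat \<Rightarrow> enat. y m < enat (x m)})"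
      by (intro open_UN ballI open_Collect_less continuous_on_const continuous_on_product_coordinates)
    ultimately show ?thesis unfolding X_def openin_open by blast
  qed
  have not_le: "\<exists>m\<ge>n. f' m < f m" if "\<not> f \<le>\<^sup>* f'" for f f' :: "nat \<Rightarrow> nat" and n
    using that unfolding eventually_le_def eventually_sequentially by (auto simp: not_le)
  have denseG: "X closure_of G n = topspace X" for n
    unfolding dense_intersects_open
  proof (intro allI impI)
    fix T assume "openin X T \<and> T \<noteq> {}"
    then obtain V where V: "open V" "T = P \<inter> V" "V \<inter> P \<noteq> {}" unfolding X_def openin_open by blast
    \<comment> \<open>Local unboundedness of \<open>P\<close> gives a scale point not below
      \<open>x\<close>.\<close>
    obtain f where f: "f \<in> B" "enat_seq f \<in> V \<inter> P" "\<not> f \<le>\<^sup>* x"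
      using unbP[OF V(1,3)] unfolding bdd_def by blast
    have "enat_seq f \<in> G n" using not_le[OF f(3)] f(2) unfolding G_def enat_seq_def by auto
    then show "G n \<inter> T \<noteq> {}" using f(2) V(2) by blast
  qed
  have denseL: "X closure_of L n = topspace X" for n
    unfolding dense_intersects_open
  proof (intro allI impI)
    fix T assume "openin X T \<and> T \<noteq> {}"
    then obtain V z where V: "open V" "T = P \<inter> V" "z \<in> V" "z \<in> P" unfolding X_def openin_open by blast
    obtain V' where V': "V' \<in> \<B>" "z \<in> V'" "V' \<subseteq> V"
      using topological_basisE[OF \<B>(2) V(1,3)] by blast
    have dV: "d V' \<in> B" "enat_seq (d V') \<in> V' \<inter> P" using d[OF V'(1)] V'(2) V(4) by blast+
    \<comment> \<open>Otherwise \<open>x\<close> would be below \<open>g\<close>; this is why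
      \<open>x\<close> was taken beyond the bound of the dense set.\<close>
    have "\<not> x \<le>\<^sup>* d V'" using g V'(1) x(3) eventually_le_trans by blast
    from not_le[OF this] have "enat_seq (d V') \<in> L n" using dV(2) unfolding L_def enat_seq_def by auto
    then show "L n \<inter> T \<noteq> {}" using dV(2) V(2) V'(3) by blast
  qed
  have "Hausdorff_space (euclidean :: enat topology)"
    unfolding Hausdorff_space_def disjnt_def using hausdorff by fastforce
  then have "Hausdorff_space (euclidean :: (nat \<Rightarrow> enat) topology)"
    using Hausdorff_space_product_topology[of "\<lambda>_::nat. euclidean :: enat topology" UNIV]
    by (simp add: euclidean_product_topology)
  then have "Hausdorff_space X" unfolding X_def by (rule Hausdorff_space_subtopology)
  moreover have "compact_space X" unfolding X_def using P by (simp add: compact_space_subtopology)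
  ultimately have "locally_compact_space X \<and> regular_space X"
    using compact_imp_locally_compact_space compact_Hausdorff_imp_regular_space by blast
  then have "X closure_of \<Inter>(range G \<union> range L) = topspace X"
    using openG openL denseG denseL by (intro Baire_category) auto
  moreover have "topspace X \<noteq> {}" using x(2) unfolding X_def by auto
  ultimately have "\<Inter>(range G \<union> range L) \<noteq> {}" by (metis closure_of_empty)
  then obtain y where "y \<in> \<Inter>(range G \<union> range L)" by auto
  then have y: "y \<in> G n" "y \<in> L n" for n by simp_all
  have "y \<notin> Q_seqs"
  proof
    assume "y \<in> Q_seqs"
    from Q_seqs_eventually_infinity[OF this] obtain N where "\<forall>n\<ge>N. y n = \<infinity>"
      unfolding eventually_sequentially by blast
    then show False using y(2)[of N] unfolding L_def by auto
  qed
  moreover have "y \<in> H" using y(1) K(2) unfolding G_def P_def by blast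
  ultimately obtain f where f: "f \<in> B" "y = enat_seq f" unfolding H_def by blast
  have "\<not> f \<le>\<^sup>* x" "\<not> x \<le>\<^sup>* f"
    using y unfolding f(2) G_def L_def enat_seq_def eventually_le_def eventually_sequentially
    by (force simp: not_le)+
  then show False using linear f(1) x(1) by blast
qed

section \<open>Covers of the scale alone\<close>

text \<open>Choosing finitely many members amounts to bounding coordinate \<open>j\<close>, which
  turns selections into bounds on the scale.\<close>

definition coord_cover :: "nat \<Rightarrow> (nat \<Rightarrow> enat) set set" where
  "coord_cover j = range (\<lambda>m. {x \<in> enat_seq ` B. x j \<le> enat m})"

lemma finite_subset_coord_cover:
  assumes "finite F" "F \<subseteq> coord_cover j"
  shows "\<exists>m. \<forall>f\<in>B. enat_seq f \<in> \<Union>F \<longrightarrow> f j \<le> m"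
proof -
  obtain M where M: "finite M" "F = (\<lambda>m. {x \<in> enat_seq ` B. x j \<le> enat m}) ` M"
    using assms unfolding coord_cover_def by (meson finite_subset_image)
  obtain m where "\<forall>i\<in>M. i \<le> m" using M(1) finite_nat_set_iff_bounded_le by auto
  then have "\<forall>f\<in>B. enat_seq f \<in> \<Union>F \<longrightarrow> f j \<le> m"
    unfolding M(2) by (auto simp: enat_seq_def intro: order_trans)
  then show ?thesis by blast
qed

text \<open>If infinitely many coordinates were bounded on \<open>B\<close>, monotonicity would
  bound \<open>B\<close>. Hence from \<open>n0\<close> on the coordinate covers have no finite
  subcover.\<close>

lemma eventually_coordinate_unbounded: "\<exists>n0. \<forall>n\<ge>n0. \<forall>m. \<exists>f\<in>B. m < f n"
proof (rule ccontr)
  assume "\<not> ?thesis"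
  then have "infinite {n. \<exists>m. \<forall>f\<in>B. f n \<le> m}"
    unfolding infinite_nat_iff_unbounded_le by (auto simp: not_less)
  moreover have "\<forall>n. \<exists>k. (\<exists>m. \<forall>f\<in>B. f n \<le> m) \<longrightarrow> (\<forall>f\<in>B. f n \<le> k)" by blast
  then obtain h where "\<And>n. (\<exists>m. \<forall>f\<in>B. f n \<le> m) \<longrightarrow> (\<forall>f\<in>B. f n \<le> h n)"
    using choice[of "\<lambda>n k. (\<exists>m. \<forall>f\<in>B. f n \<le> m) \<longrightarrow> (\<forall>f\<in>B. f n \<le> k)"] by blast
  ultimately have "\<exists>g. \<forall>f\<in>B. f \<le>\<^sup>* g"
    using strict_mono_mono[OF strict_mono]
    by (intro bounded_family_if_infinitely_often_bounded[of B _ h]) auto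
  then show False using unbounded unfolding unbounded_family_def by blast
qed

text \<open>Unboundedness at \<open>j\<close> rules out finite subcovers, hence also a finite family
  and a member containing the whole space; a point \<open>f\<close> is missing only from members
  with \<open>m < f j\<close>.\<close>

lemma coord_cover_gamma:
  assumes j: "\<And>m. \<exists>f\<in>B. m < f j"
  shows "coord_cover j \<in> \<Gamma> (top_of_set (enat_seq ` B))"
    and "\<not> (\<exists>F. finite F \<and> F \<subseteq> coord_cover j \<and> topspace (top_of_set (enat_seq ` B)) \<subseteq> \<Union>F)"
proof -
  show no_fin: "\<not> (\<exists>F. finite F \<and> F \<subseteq> coord_cover j \<and> topspace (top_of_set (enat_seq ` B)) \<subseteq> \<Union>F)"
  proof
    assume "\<exists>F. finite F \<and> F \<subseteq> coord_cover j \<and> topspace (top_of_set (enat_seq ` B)) \<subseteq> \<Union>F"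
    then obtain F where F: "finite F" "F \<subseteq> coord_cover j" "enat_seq ` B \<subseteq> \<Union>F" by auto
    obtain m where "\<forall>f\<in>B. enat_seq f \<in> \<Union>F \<longrightarrow> f j \<le> m"
      using finite_subset_coord_cover[OF F(1,2)] ..
    then show False using j[of m] F(3) by (meson imageI leD subsetD)
  qed
  have cover: "enat_seq ` B \<subseteq> \<Union>(coord_cover j)"
    unfolding coord_cover_def by (auto simp: enat_seq_def)
  have "openin (top_of_set (enat_seq ` B)) V" if V: "V \<in> coord_cover j" for V
  proof -
    obtain m where "V = enat_seq ` B \<inter> {x. x j \<le> enat m}" using V unfolding coord_cover_def by auto
    then show ?thesis using open_coordinate_le unfolding openin_open by blast
  qed
  moreover have "infinite (coord_cover j)" using no_fin cover by auto
  moreover have "\<not> enat_seq ` B \<subseteq> V" if "V \<in> coord_cover j" for V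
    using no_fin that by (auto dest: spec[of _ "{V}"])
  moreover have "finite {V \<in> coord_cover j. x \<notin> V}" if x: "x \<in> enat_seq ` B" for x
  proof -
    obtain f where f: "x = enat_seq f" using x by blast
    have "{V \<in> coord_cover j. x \<notin> V} \<subseteq> (\<lambda>m. {x \<in> enat_seq ` B. x j \<le> enat m}) ` {..<f j}"
    proof clarify
      fix V assume "V \<in> coord_cover j" "x \<notin> V"
      then obtain m where m: "V = {x \<in> enat_seq ` B. x j \<le> enat m}" "x \<notin> V"
        unfolding coord_cover_def by blast
      with x f have "m < f j" by (auto simp: enat_seq_def)
      with m(1) show "V \<in> (\<lambda>m. {x \<in> enat_seq ` B. x j \<le> enat m}) ` {..<f j}" by blast
    qed
    then show ?thesis by (rule finite_subset) simp
  qed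
  ultimately show "coord_cover j \<in> \<Gamma> (top_of_set (enat_seq ` B))"
    using cover unfolding gamma_covers_def open_covers_def by (auto simp: coord_cover_def)
qed

text \<open>A selection forming a \<open>\<gamma>\<close>-cover would bound all of \<open>B\<close>
  along one infinite set of coordinates.\<close>

lemma not_Ufin_gamma_gamma_B: "\<not> Ufin \<Gamma> \<Gamma> (top_of_set (enat_seq ` B))"
proof
  assume Uf: "Ufin \<Gamma> \<Gamma> (top_of_set (enat_seq ` B))"
  obtain n0 where n0: "\<And>n m. n0 \<le> n \<Longrightarrow> \<exists>f\<in>B. m < f n" using eventually_coordinate_unbounded by blast
  have "\<exists>F. (\<forall>n. finite (F n) \<and> F n \<subseteq> coord_cover (n0 + n)) \<and>
      range (\<lambda>n. \<Union>(F n)) \<in> \<Gamma> (top_of_set (enat_seq ` B))"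
    by (intro UfinD[OF Uf] coord_cover_gamma n0) simp_all
  then obtain F where F: "\<And>n. finite (F n)" "\<And>n. F n \<subseteq> coord_cover (n0 + n)"
    and ran: "range (\<lambda>n. \<Union>(F n)) \<in> \<Gamma> (top_of_set (enat_seq ` B))" by blast
  obtain h where h: "\<And>n f. f \<in> B \<Longrightarrow> enat_seq f \<in> \<Union>(F n) \<Longrightarrow> f (n0 + n) \<le> h n"
    using finite_subset_coord_cover[OF F] by metis
  \<comment> \<open>The \<open>\<gamma>\<close>-cover is only a set, so a value may repeat along infinitely many \<open>n\<close>;
      \<open>J\<close> selects one index per value.\<close>
  obtain J where J: "inj_on (\<lambda>n. \<Union>(F n)) J" "range (\<lambda>n. \<Union>(F n)) = (\<lambda>n. \<Union>(F n)) ` J"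
    using subset_image_inj[of "range (\<lambda>n. \<Union>(F n))" "\<lambda>n. \<Union>(F n)" UNIV] by auto
  have "infinite J" using ran J(2) unfolding gamma_covers_def by auto
  then have inf: "infinite ((+) n0 ` J)" by (simp add: finite_image_iff)
  have "\<exists>N. \<forall>n\<in>(+) n0 ` J. N \<le> n \<longrightarrow> f n \<le> h (n - n0)" if f: "f \<in> B" for f
  proof -
    have "finite {V \<in> range (\<lambda>n. \<Union>(F n)). enat_seq f \<notin> V}"
      using ran f unfolding gamma_covers_def by auto
    then have "finite ((\<lambda>n. \<Union>(F n)) ` {n \<in> J. enat_seq f \<notin> \<Union>(F n)})"
      by (rule finite_subset[rotated]) auto
    then have "finite {n \<in> J. enat_seq f \<notin> \<Union>(F n)}"
      by (rule finite_imageD) (rule inj_on_subset[OF J(1)], blast)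
    then obtain N where N: "\<forall>n\<in>{n \<in> J. enat_seq f \<notin> \<Union>(F n)}. n < N"
      unfolding finite_nat_set_iff_bounded ..
    then have "\<forall>n\<in>(+) n0 ` J. n0 + N \<le> n \<longrightarrow> f n \<le> h (n - n0)"
      using h[OF f] by fastforce
    then show ?thesis by blast
  qed
  then have "\<exists>g. \<forall>f\<in>B. f \<le>\<^sup>* g"
    using strict_mono_mono[OF strict_mono] inf
    by (intro bounded_family_if_infinitely_often_bounded[of B "(+) n0 ` J" "\<lambda>n. h (n - n0)"]) auto
  then show False using unbounded unfolding unbounded_family_def by blast
qed

text \<open>A mere cover bounds each \<open>f\<close> at only one coordinate, so the selection is
  repeated on every tail \<open>N\<close>. A scale member dominating all these bounds violates the
  one for the tail on which domination holds.\<close>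

lemma not_Ufin_gamma_open_B:
  assumes dom: "dominating_family B"
  shows "\<not> Ufin \<Gamma> \<O> (top_of_set (enat_seq ` B))"
proof
  assume Uf: "Ufin \<Gamma> \<O> (top_of_set (enat_seq ` B))"
  obtain n0 where n0: "\<And>n m. n0 \<le> n \<Longrightarrow> \<exists>f\<in>B. m < f n" using eventually_coordinate_unbounded by blast
  have "\<exists>h. \<forall>f\<in>B. \<exists>n. f (n0 + N + n) \<le> h n" for N
  proof -
    have "\<exists>F. (\<forall>n. finite (F n) \<and> F n \<subseteq> coord_cover (n0 + N + n)) \<and>
        range (\<lambda>n. \<Union>(F n)) \<in> \<O> (top_of_set (enat_seq ` B))"
      by (intro UfinD[OF Uf] coord_cover_gamma n0) simp_all
    then obtain F where F: "\<And>n. finite (F n)" "\<And>n. F n \<subseteq> coord_cover (n0 + N + n)"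
      and ran: "range (\<lambda>n. \<Union>(F n)) \<in> \<O> (top_of_set (enat_seq ` B))" by blast
    obtain h where h: "\<And>n f. f \<in> B \<Longrightarrow> enat_seq f \<in> \<Union>(F n) \<Longrightarrow> f (n0 + N + n) \<le> h n"
      using finite_subset_coord_cover[OF F] by metis
    have "enat_seq ` B \<subseteq> (\<Union>n. \<Union>(F n))" using ran unfolding open_covers_def by auto
    then show ?thesis using h by (intro exI[of _ h]) blast
  qed
  then obtain h where h: "\<And>N f. f \<in> B \<Longrightarrow> \<exists>n. f (n0 + N + n) \<le> h N n" by metis
  \<comment> \<open>Exceeds every \<open>h N\<close> at the shifted argument; where
    \<open>j < n0 + N\<close> truncated subtraction only adds a summand
    \<open>h N 0\<close>.\<close>
  define k where "k j = Suc (\<Sum>N\<le>j. h N (j - (n0 + N)))" for j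
  obtain f where f: "f \<in> B" "k \<le>\<^sup>* f" using dom unfolding dominating_family_def by blast
  then obtain N where N: "\<And>n. N \<le> n \<Longrightarrow> k n \<le> f n"
    unfolding eventually_le_def eventually_sequentially by blast
  obtain n where n: "f (n0 + N + n) \<le> h N n" using h[OF f(1)] by blast
  have "h N n < k (n0 + N + n)"
    using member_le_sum[of N "{..n0 + N + n}" "\<lambda>M. h M (n0 + N + n - (n0 + M))"]
    unfolding k_def by (simp add: less_Suc_eq_le)
  with n N[of "n0 + N + n"] show False by simp
qed

end

theorem theorem4p3:
  shows "\<exists>H \<subseteq> incr_seqs. \<not> sigma_compact H \<and>
    |H| =o \<bb> \<and>
    (S1 \<Gamma> \<O> (top_of_set H) \<and>
     (\<forall>k. Ufin \<Gamma> \<Gamma> (power_topology (top_of_set H) k)) \<and>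
     \<not> Ufin \<Gamma> \<Gamma> (top_of_set (H - Q_seqs))) \<and>
    (\<bb> =o \<dd> \<longrightarrow> \<not> Ufin \<Gamma> \<O> (top_of_set (H - Q_seqs)))"
proof -
  obtain B0 where B0: "unbounded_family B0" "\<And>C. unbounded_family C \<Longrightarrow> |B0| \<le>o |C|" "\<bb> = |B0|"
    using min_card_attained[of unbounded_family, OF unbounded_family_UNIV]
    unfolding bounding_number_def by blast
  obtain D where D: "dominating_family D" "\<dd> = |D|"
    using min_card_attained[of dominating_family, OF dominating_family_UNIV]
    unfolding dominating_number_def by blast
  have D_unb: "unbounded_family D"
    unfolding unbounded_family_def
  proof
    assume "\<exists>g. \<forall>f\<in>D. f \<le>\<^sup>* g"
    then obtain g where g: "\<forall>f\<in>D. f \<le>\<^sup>* g" by blast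
    \<comment> \<open>A dominating family cannot be bounded by \<open>g\<close>, since some member
      dominates the successor of \<open>g\<close>.\<close>
    obtain f where "f \<in> D" "(\<lambda>n. Suc (g n)) \<le>\<^sup>* f"
      using D(1) unfolding dominating_family_def by blast
    then have "(\<lambda>n. Suc (g n)) \<le>\<^sup>* g" using g eventually_le_trans by blast
    then show False by (simp add: eventually_le_def)
  qed
  \<comment> \<open>If \<open>\<bb> =o \<dd>\<close>, a least dominating family is also an unbounded
    family of least size, and the scale built from it is dominating; so one construction serves both
    cases.\<close>
  define A where "A = (if \<bb> =o \<dd> then D else B0)"
  have A_card: "|A| =o \<bb>"
    using D(2) B0(3) ordIso_symmetric[of \<bb> \<dd>] card_of_refl[of B0] unfolding A_def by simp
  have "unbounded_family A" unfolding A_def using D_unb B0(1) by simp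
  moreover have "|A| \<le>o |C|" if "unbounded_family C" for C
    using ordIso_ordLeq_trans[OF A_card] B0(2)[OF that] B0(3) by simp
  ultimately obtain B where B: "b_scale B" "|B| =o |A|" "\<forall>a\<in>A. \<exists>f\<in>B. a \<le>\<^sup>* f"
    using b_scale_exists by blast
  interpret b_scale B by (fact B(1))
  have "dominating_family B" if "\<bb> =o \<dd>"
    using D(1) B(3) that unfolding A_def dominating_family_def by (metis eventually_le_trans)
  then have "\<bb> =o \<dd> \<longrightarrow> \<not> Ufin \<Gamma> \<O> (top_of_set (H - Q_seqs))"
    unfolding H_minus_Q_seqs using not_Ufin_gamma_open_B by blast
  moreover have "|H| =o \<bb>"
    using card_H B(2) A_card ordIso_transitive by blast
  moreover have "Ufin \<Gamma> \<Gamma> (power_topology (top_of_set H) k)" for k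
    unfolding power_topology_def
    by (intro Ufin_gamma_gamma_if_increasing_covers_bounded increasing_covers_bounded_power_H) simp
  ultimately show ?thesis
    using H_subset_incr_seqs not_sigma_compact_H S1_gamma_open_H not_Ufin_gamma_gamma_B
    by (intro exI[of _ H]) (simp add: H_minus_Q_seqs)
qed

end
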